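(* Let $X$ be a vector lattice such that $X_n^\sim$ separates points of $X$ (this is satisfied if $X$ is an order continuous Banach lattice). Then the universal completion $X^{\mathrm{u}}$ of $X$ is uo-complete, and every uo-Cauchy net in $X$ is uo-convergent in $X^{\mathrm{u}}$.
   Context: All vector lattices are assumed to be Archimedean. A vector lattice is order complete if every order bounded (nonempty) subset has a supremum, laterally complete if every collection of mutually disjoint positive vectors admits a supremum, and universally complete if it is both order complete and laterally complete. The universal completion $X^{\mathrm{u}}$ of $X$ is the (unique up to lattice isomorphism) universally complete vector lattice containing $X$ as an order dense sublattice. A net $(x_\alpha)_{\alpha\in\Gamma}$ in a vector lattice $X$ converges in order to $x\in X$, written $x_\alpha\xrightarrow{\mathrm{o}}x$, if there is another net $(a_\gamma)_{\gamma\in\Lambda}$ in $X$ (possibly with a different index set) with $a_\gamma\downarrow 0$ such that for every $\gamma\in\Lambda$ there exists $\alpha_0\in\Gamma$ with $|x_\alpha-x|\le a_\gamma$ for all $\alpha\ge\alpha_0$. The net uo-converges to $x$ if $|x_\alpha-x|\wedge y\xrightarrow{\mathrm{o}}0$ for every $y\in X_+$. The net is uo-Cauchy if the doubly indexed net $(x_\alpha-x_{\alpha'})_{(\alpha,\alpha')\in\Gamma\times\Gamma}$ (with $\Gamma\times\Gamma$ directed coordinatewise) uo-converges to $0$. A vector lattice is uo-complete if every uo-Cauchy net in it is uo-convergent to some element of it. "Uo-convergent in $X^{\mathrm{u}}$" means that the net, viewed in $X^{\mathrm{u}}$, uo-converges in $X^{\mathrm{u}}$ to some element of $X^{\mathrm{u}}$.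 A linear functional $f$ on $X$ is order continuous if $f(x_\alpha)\to 0$ whenever $x_\alpha\xrightarrow{\mathrm{o}}0$; $X_n^\sim$ denotes the collection of all order continuous functionals on $X$. It separates points of $X$ if for every $x\ne 0$ in $X$ there is $f\in X_n^\sim$ with $f(x)\neq 0$. A Banach lattice is order continuous if $\|x_\alpha\|\to 0$ for every net $x_\alpha\downarrow 0$. *)

theory Defs
  imports "HOL-Analysis.Analysis" "HOL-Library.Lattice_Algebras" "HOL-Library.Lub_Glb"
begin

section \<open>Vector lattices\<close>

class vector_lattice = ordered_real_vector + lattice_ab_group_add_abs

class archimedean_vector_lattice = vector_lattice +
  assumes archimedean: "(\<And>n. of_nat n *\<^sub>R x \<le> y) \<Longrightarrow> x \<le> 0"

class banach_lattice = vector_lattice + banach +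
  assumes norm_mono: "\<bar>x\<bar> \<le> \<bar>y\<bar> \<Longrightarrow> norm x \<le> norm y"

instance banach_lattice \<subseteq> archimedean_vector_lattice
proof
  fix x y :: 'a
  assume le: "\<And>n. of_nat n *\<^sub>R x \<le> y"
  define p where "p = sup x 0"
  have p0: "0 \<le> p" by (simp add: p_def)
  have bound: "real n * norm p \<le> norm (sup y 0)" for n
  proof (cases "n = 0")
    case False
    have "x \<le> inverse (real n) *\<^sub>R sup y 0"
    proof -
      have "real n *\<^sub>R x \<le> sup y 0"
        using le[of n] by (simp add: le_supI1)
      then have "inverse (real n) *\<^sub>R (real n *\<^sub>R x) \<le> inverse (real n) *\<^sub>R sup y 0"
        by (rule scaleR_left_mono) simp
      then show ?thesis using False by simp
    qed
    moreover have "0 \<le> inverse (real n) *\<^sub>R sup y 0"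
      by (intro scaleR_nonneg_nonneg) auto
    ultimately have "p \<le> inverse (real n) *\<^sub>R sup y 0"
      by (simp add: p_def)
    then have "real n *\<^sub>R p \<le> real n *\<^sub>R (inverse (real n) *\<^sub>R sup y 0)"
      by (rule scaleR_left_mono) simp
    then have "real n *\<^sub>R p \<le> sup y 0" using False by simp
    moreover have "0 \<le> real n *\<^sub>R p"
      using p0 by (intro scaleR_nonneg_nonneg) auto
    ultimately have "norm (real n *\<^sub>R p) \<le> norm (sup y 0)"
      by (intro norm_mono) (simp add: abs_of_nonneg)
    then show ?thesis by simp
  qed simp
  have "norm p = 0"
  proof (rule ccontr)
    assume "norm p \<noteq> 0"
    then obtain n where "norm (sup y 0) < real n * norm p"
      using reals_Archimedean3[of "norm p"] by auto
    with bound[of n] show False by simp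
  qed
  then show "x \<le> 0"
    by (metis norm_eq_zero p_def sup_ge1)
qed

section \<open>Nets and order convergence\<close>

text \<open>
  A net consists of a set \<open>\<Gamma>\<close> directed by a preorder \<open>le\<close> and a function on \<open>\<Gamma>\<close>; the values of
  the function and of \<open>le\<close> outside \<open>\<Gamma>\<close> are irrelevant.
\<close>

definition directed :: "'i set \<Rightarrow> ('i \<Rightarrow> 'i \<Rightarrow> bool) \<Rightarrow> bool" where
  "directed \<Gamma> le \<longleftrightarrow> \<Gamma> \<noteq> {} \<and> reflp_on \<Gamma> le \<and> transp_on \<Gamma> le \<and>
     (\<forall>\<alpha>\<in>\<Gamma>. \<forall>\<beta>\<in>\<Gamma>. \<exists>\<gamma>\<in>\<Gamma>. le \<alpha> \<gamma> \<and> le \<beta> \<gamma>)"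

definition net_filter :: "'i set \<Rightarrow> ('i \<Rightarrow> 'i \<Rightarrow> bool) \<Rightarrow> 'i filter" where
  "net_filter \<Gamma> le = (INF \<alpha>\<in>\<Gamma>. principal {\<beta>\<in>\<Gamma>. le \<alpha> \<beta>})"

lemma eventually_net_filter:
  assumes "directed \<Gamma> le"
  shows "eventually P (net_filter \<Gamma> le) \<longleftrightarrow> (\<exists>\<alpha>\<in>\<Gamma>. \<forall>\<beta>\<in>\<Gamma>. le \<alpha> \<beta> \<longrightarrow> P \<beta>)"
proof -
  have "eventually P (net_filter \<Gamma> le)
      \<longleftrightarrow> (\<exists>\<alpha>\<in>\<Gamma>. eventually P (principal {\<beta>\<in>\<Gamma>. le \<alpha> \<beta>}))"
    unfolding net_filter_def
  proof (rule eventually_INF_base)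
    show "\<Gamma> \<noteq> {}" using assms by (simp add: directed_def)
    fix a b assume ab: "a \<in> \<Gamma>" "b \<in> \<Gamma>"
    then obtain c where c: "c \<in> \<Gamma>" "le a c" "le b c"
      using assms unfolding directed_def by blast
    have "{\<beta>\<in>\<Gamma>. le c \<beta>} \<subseteq> {\<beta>\<in>\<Gamma>. le a \<beta>} \<inter> {\<beta>\<in>\<Gamma>. le b \<beta>}"
      using assms ab c unfolding directed_def by (auto dest: transp_onD)
    then show "\<exists>x\<in>\<Gamma>. principal {\<beta>\<in>\<Gamma>. le x \<beta>}
        \<le> inf (principal {\<beta>\<in>\<Gamma>. le a \<beta>}) (principal {\<beta>\<in>\<Gamma>. le b \<beta>})"
      using c(1) by auto
  qed
  then show ?thesis by (auto simp: eventually_principal)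
qed

definition decreases_to_zero ::
    "'i set \<Rightarrow> ('i \<Rightarrow> 'i \<Rightarrow> bool) \<Rightarrow> ('i \<Rightarrow> 'a::vector_lattice) \<Rightarrow> bool" where
  "decreases_to_zero \<Gamma> le a \<longleftrightarrow> directed \<Gamma> le \<and>
     (\<forall>\<alpha>\<in>\<Gamma>. \<forall>\<beta>\<in>\<Gamma>. le \<alpha> \<beta> \<longrightarrow> a \<beta> \<le> a \<alpha>) \<and> isGlb UNIV (a ` \<Gamma>) 0"

text \<open>
  A quantifier inside a definition cannot range over all index types. Here the dominating net
  is indexed by a directed set of elements of the lattice itself; this is no restriction, since
  a decreasing net can be reindexed by its range with the reversed order. Lemma
  \<open>order_convergesI\<close> below says that dominating nets over any index type suffice.
\<close>

definition order_converges ::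
    "'i set \<Rightarrow> ('i \<Rightarrow> 'i \<Rightarrow> bool) \<Rightarrow> ('i \<Rightarrow> 'a::vector_lattice) \<Rightarrow> 'a \<Rightarrow> bool" where
  "order_converges \<Gamma> le x l \<longleftrightarrow>
     (\<exists>(\<Lambda> :: 'a set) le' a. decreases_to_zero \<Lambda> le' a \<and>
        (\<forall>\<gamma>\<in>\<Lambda>. \<exists>\<alpha>0\<in>\<Gamma>. \<forall>\<alpha>\<in>\<Gamma>. le \<alpha>0 \<alpha> \<longrightarrow> \<bar>x \<alpha> - l\<bar> \<le> a \<gamma>))"

lemma decreases_to_zero_range:
  assumes "decreases_to_zero \<Lambda> le a"
  shows "decreases_to_zero (a ` \<Lambda>) (\<ge>) (\<lambda>u. u)"
proof -
  have "\<exists>w\<in>a ` \<Lambda>. w \<le> u \<and> w \<le> v" if uv: "u \<in> a ` \<Lambda>" "v \<in> a ` \<Lambda>" for u v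
  proof -
    obtain \<alpha> \<beta> where "\<alpha> \<in> \<Lambda>" "\<beta> \<in> \<Lambda>" "u = a \<alpha>" "v = a \<beta>"
      using uv by blast
    moreover from this obtain \<gamma> where "\<gamma> \<in> \<Lambda>" "le \<alpha> \<gamma>" "le \<beta> \<gamma>"
      using assms unfolding decreases_to_zero_def directed_def by meson
    ultimately show ?thesis
      using assms unfolding decreases_to_zero_def by (intro bexI[of _ "a \<gamma>"]) auto
  qed
  then show ?thesis
    using assms unfolding decreases_to_zero_def directed_def
    by (auto intro!: reflp_onI transp_onI)
qed

lemma order_convergesI:
  fixes \<Lambda> :: "'j set"
  assumes "decreases_to_zero \<Lambda> le' a"
    and "\<And>\<gamma>. \<gamma> \<in> \<Lambda> \<Longrightarrow> \<exists>\<alpha>0\<in>\<Gamma>. \<forall>\<alpha>\<in>\<Gamma>. le \<alpha>0 \<alpha> \<longrightarrow> \<bar>x \<alpha> - l\<bar> \<le> a \<gamma>"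
  shows "order_converges \<Gamma> le x l"
  unfolding order_converges_def
  using decreases_to_zero_range[OF assms(1)] assms(2) by blast

definition uo_converges ::
    "'i set \<Rightarrow> ('i \<Rightarrow> 'i \<Rightarrow> bool) \<Rightarrow> ('i \<Rightarrow> 'a::vector_lattice) \<Rightarrow> 'a \<Rightarrow> bool" where
  "uo_converges \<Gamma> le x l \<longleftrightarrow>
     (\<forall>y\<ge>0. order_converges \<Gamma> le (\<lambda>\<alpha>. inf \<bar>x \<alpha> - l\<bar> y) 0)"

text \<open>\<open>rel_prod le le\<close> is the coordinatewise preorder on pairs.\<close>

definition uo_Cauchy ::
    "'i set \<Rightarrow> ('i \<Rightarrow> 'i \<Rightarrow> bool) \<Rightarrow> ('i \<Rightarrow> 'a::vector_lattice) \<Rightarrow> bool" where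
  "uo_Cauchy \<Gamma> le x \<longleftrightarrow>
     uo_converges (\<Gamma> \<times> \<Gamma>) (rel_prod le le) (\<lambda>(\<alpha>, \<alpha>'). x \<alpha> - x \<alpha>') 0"

text \<open>
  The first type argument is the index type of the nets. Uo-completeness in the usual sense is
  obtained by leaving it an unconstrained type variable in the conclusion of a theorem, which
  is thereby asserted for nets over every index type.
\<close>

definition uo_complete :: "'i itself \<Rightarrow> 'a::vector_lattice itself \<Rightarrow> bool" where
  "uo_complete TYPE('i) TYPE('a) \<longleftrightarrow>
     (\<forall>(\<Gamma> :: 'i set) le (x :: 'i \<Rightarrow> 'a).
        directed \<Gamma> le \<longrightarrow> uo_Cauchy \<Gamma> le x \<longrightarrow> (\<exists>l. uo_converges \<Gamma> le x l))"

section \<open>Order continuity\<close>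

text \<open>
  The nets in the next two definitions are indexed by directed sets of elements of the lattice.
  The lemmas following the definitions show that the condition then holds for nets over every
  index type.
\<close>

definition order_continuous_dual :: "('a::vector_lattice \<Rightarrow> real) set" where
  "order_continuous_dual = {f. linear f \<and>
     (\<forall>(\<Gamma> :: 'a set) le x. directed \<Gamma> le \<longrightarrow> order_converges \<Gamma> le x 0 \<longrightarrow>
        ((\<lambda>\<alpha>. f (x \<alpha>)) \<longlongrightarrow> 0) (net_filter \<Gamma> le))}"

lemma order_continuous_dualD:
  fixes \<Gamma> :: "'j set" and x :: "'j \<Rightarrow> 'a::vector_lattice"
  assumes f: "f \<in> order_continuous_dual"
    and dir: "directed \<Gamma> le" and conv: "order_converges \<Gamma> le x 0"
  shows "((\<lambda>\<alpha>. f (x \<alpha>)) \<longlongrightarrow> 0) (net_filter \<Gamma> le)"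
proof (rule tendstoI, rule ccontr)
  fix e :: real
  assume e: "0 < e"
    and "\<not> eventually (\<lambda>\<alpha>. dist (f (x \<alpha>)) 0 < e) (net_filter \<Gamma> le)"
  then have bad: "\<exists>\<beta>\<in>\<Gamma>. le \<alpha> \<beta> \<and> e \<le> \<bar>f (x \<beta>)\<bar>" if "\<alpha> \<in> \<Gamma>" for \<alpha>
    using that by (force simp: eventually_net_filter[OF dir])
  obtain \<Lambda> :: "'a set" and le' a where dec: "decreases_to_zero \<Lambda> le' a"
    and dom: "\<And>\<gamma>. \<gamma> \<in> \<Lambda> \<Longrightarrow> \<exists>\<alpha>0\<in>\<Gamma>. \<forall>\<alpha>\<in>\<Gamma>. le \<alpha>0 \<alpha> \<longrightarrow> \<bar>x \<alpha> - 0\<bar> \<le> a \<gamma>"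
    using conv unfolding order_converges_def by blast
  have "\<exists>\<beta>. \<beta> \<in> \<Gamma> \<and> \<bar>x \<beta>\<bar> \<le> a \<gamma> \<and> e \<le> \<bar>f (x \<beta>)\<bar>" if "\<gamma> \<in> \<Lambda>" for \<gamma>
    using dom[OF that] bad by (metis diff_zero)
  then obtain b where b: "\<And>\<gamma>. \<gamma> \<in> \<Lambda> \<Longrightarrow> \<bar>x (b \<gamma>)\<bar> \<le> a \<gamma> \<and> e \<le> \<bar>f (x (b \<gamma>))\<bar>"
    by metis
  have dir': "directed \<Lambda> le'" using dec by (simp add: decreases_to_zero_def)
  have "order_converges \<Lambda> le' (\<lambda>\<gamma>. x (b \<gamma>)) 0"
  proof (rule order_convergesI[OF dec])
    fix \<gamma> assume g: "\<gamma> \<in> \<Lambda>"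
    have "\<bar>x (b \<delta>) - 0\<bar> \<le> a \<gamma>" if "\<delta> \<in> \<Lambda>" "le' \<gamma> \<delta>" for \<delta>
      using b[OF that(1)] dec g that unfolding decreases_to_zero_def
      by (metis diff_zero order_trans)
    then show "\<exists>\<alpha>0\<in>\<Lambda>. \<forall>\<alpha>\<in>\<Lambda>. le' \<alpha>0 \<alpha> \<longrightarrow> \<bar>x (b \<alpha>) - 0\<bar> \<le> a \<gamma>"
      using g by blast
  qed
  then have "((\<lambda>\<gamma>. f (x (b \<gamma>))) \<longlongrightarrow> 0) (net_filter \<Lambda> le')"
    using f dir' unfolding order_continuous_dual_def
    by (auto dest!: spec[of _ \<Lambda>])
  then have "eventually (\<lambda>\<gamma>. dist (f (x (b \<gamma>))) 0 < e) (net_filter \<Lambda> le')"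
    using e by (rule tendstoD)
  then obtain \<gamma> where "\<gamma> \<in> \<Lambda>" "\<forall>\<delta>\<in>\<Lambda>. le' \<gamma> \<delta> \<longrightarrow> \<bar>f (x (b \<delta>))\<bar> < e"
    by (auto simp: eventually_net_filter[OF dir'])
  moreover have "le' \<gamma> \<gamma>"
    using dir' \<open>\<gamma> \<in> \<Lambda>\<close> by (auto simp: directed_def dest: reflp_onD)
  ultimately show False using b[of \<gamma>] by force
qed

definition order_continuous_norm :: "'a::banach_lattice itself \<Rightarrow> bool" where
  "order_continuous_norm TYPE('a) \<longleftrightarrow>
     (\<forall>(\<Gamma> :: 'a set) le (x :: 'a \<Rightarrow> 'a). decreases_to_zero \<Gamma> le x \<longrightarrow>
        ((\<lambda>\<alpha>. norm (x \<alpha>)) \<longlongrightarrow> 0) (net_filter \<Gamma> le))"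

lemma order_continuous_normD:
  fixes \<Gamma> :: "'j set" and x :: "'j \<Rightarrow> 'a::banach_lattice"
  assumes oc: "order_continuous_norm TYPE('a)" and dec: "decreases_to_zero \<Gamma> le x"
  shows "((\<lambda>\<alpha>. norm (x \<alpha>)) \<longlongrightarrow> 0) (net_filter \<Gamma> le)"
proof (rule tendstoI)
  fix e :: real assume e: "0 < e"
  note dec' = decreases_to_zero_range[OF dec]
  then have dir': "directed (x ` \<Gamma>) (\<ge>)" and dir: "directed \<Gamma> le"
    using dec by (simp_all add: decreases_to_zero_def)
  have "((\<lambda>u. norm u) \<longlongrightarrow> 0) (net_filter (x ` \<Gamma>) (\<ge>))"
    using oc dec' unfolding order_continuous_norm_def by blast
  then have "eventually (\<lambda>u. dist (norm u) 0 < e) (net_filter (x ` \<Gamma>) (\<ge>))"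
    using e by (rule tendstoD)
  then obtain \<alpha> where "\<alpha> \<in> \<Gamma>" "\<forall>\<beta>\<in>\<Gamma>. x \<beta> \<le> x \<alpha> \<longrightarrow> norm (x \<beta>) < e"
    by (auto simp: eventually_net_filter[OF dir'])
  then show "eventually (\<lambda>\<alpha>. dist (norm (x \<alpha>)) 0 < e) (net_filter \<Gamma> le)"
    using dec unfolding eventually_net_filter[OF dir] decreases_to_zero_def by auto
qed

definition separates_points :: "('a::zero \<Rightarrow> real) set \<Rightarrow> bool" where
  "separates_points F \<longleftrightarrow> (\<forall>x. x \<noteq> 0 \<longrightarrow> (\<exists>f\<in>F. f x \<noteq> 0))"

section \<open>Universal completions\<close>

definition order_complete :: "'a::vector_lattice itself \<Rightarrow> bool" where
  "order_complete TYPE('a) \<longleftrightarrow>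
     (\<forall>S :: 'a set. S \<noteq> {} \<longrightarrow> (\<exists>a b. S \<subseteq> {a..b}) \<longrightarrow> (\<exists>s. isLub UNIV S s))"

text \<open>Only nonempty sets are considered: a nonzero vector lattice has no least element.\<close>

definition laterally_complete :: "'a::vector_lattice itself \<Rightarrow> bool" where
  "laterally_complete TYPE('a) \<longleftrightarrow>
     (\<forall>S :: 'a set. S \<noteq> {} \<longrightarrow> (\<forall>x\<in>S. 0 \<le> x) \<longrightarrow>
        pairwise (\<lambda>x y. inf \<bar>x\<bar> \<bar>y\<bar> = 0) S \<longrightarrow> (\<exists>s. isLub UNIV S s))"

definition universally_complete :: "'a::vector_lattice itself \<Rightarrow> bool" where
  "universally_complete TYPE('a) \<longleftrightarrow> order_complete TYPE('a) \<and> laterally_complete TYPE('a)"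

definition lattice_embedding :: "('a::vector_lattice \<Rightarrow> 'u::vector_lattice) \<Rightarrow> bool" where
  "lattice_embedding J \<longleftrightarrow> linear J \<and> inj J \<and>
     (\<forall>x y. J (sup x y) = sup (J x) (J y)) \<and> (\<forall>x y. J (inf x y) = inf (J x) (J y))"

definition order_dense :: "'u::vector_lattice set \<Rightarrow> bool" where
  "order_dense Y \<longleftrightarrow> (\<forall>u>0. \<exists>y\<in>Y. 0 < y \<and> y \<le> u)"

text \<open>The type \<open>'u\<close> with the embedding \<open>J\<close> is a universal completion of \<open>'a\<close>.\<close>

definition universal_completion ::
    "('a::archimedean_vector_lattice \<Rightarrow> 'u::archimedean_vector_lattice) \<Rightarrow> bool" where
  "universal_completion J \<longleftrightarrow>
     universally_complete TYPE('u) \<and> lattice_embedding J \<and> order_dense (range J)"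

end

theory Submission
  imports Defs
begin

text \<open>
  Every universally complete vector lattice \<open>U\<close> is uo-complete, for the following reason. The
  positive and negative parts of a uo-Cauchy net are treated separately, so let the net be
  positive. Its limit must be its lower limit, the supremum of the set \<open>A\<close> of its eventual lower
  bounds, and the only question is whether \<open>A\<close> has an upper bound. The Cauchy condition shows that
  \<open>A\<close> is bounded on small bands: below every \<open>v > 0\<close> there is some \<open>z > 0\<close> such that, on the band
  generated by \<open>z\<close>, the elements of a tail differ by at most \<open>v\<close>, so that \<open>A\<close> is bounded there
  (\<open>positive_locally_Cauchy_limit\<close>). Lateral completeness glues the suprema over a maximal disjoint
  family of such bands together to an upper bound (\<open>locally_bounded_imp_bounded\<close>). The infinite
  distributive law then bounds the truncated distance between the net and its lower limit by the
  truncated oscillation of the tails, which decreases to \<open>0\<close> (\<open>oscillation_bound\<close>).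

  The argument uses only a local form of the Cauchy condition, and a uo-Cauchy net in an order dense
  sublattice satisfies it in the ambient lattice (\<open>uo_Cauchy_imp_locally_Cauchy\<close>). This gives the
  statement about nets in \<open>X\<close>, and with the identity as the embedding also the one about nets in the
  universal completion.

  In a Banach lattice with order continuous norm every bounded functional is order continuous, and
  bounded functionals separate points by the Hahn-Banach theorem. The latter is proved here by
  finding a minimal sublinear functional below the norm, which is automatically linear
  (\<open>Hahn_Banach_sublinear\<close>).
\<close>

section \<open>Suprema in vector lattices\<close>
lemma isGlb_UNIV_iff:
  "isGlb UNIV S m \<longleftrightarrow> (\<forall>a\<in>S. m \<le> a) \<and> (\<forall>c. (\<forall>a\<in>S. c \<le> a) \<longrightarrow> c \<le> m)"
  by (auto simp: isGlb_def greatestP_def isLb_def setle_def setge_def)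

lemma isLub_UNIV_iff:
  "isLub UNIV S m \<longleftrightarrow> (\<forall>a\<in>S. a \<le> m) \<and> (\<forall>c. (\<forall>a\<in>S. a \<le> c) \<longrightarrow> m \<le> c)"
  by (auto simp: isLub_def leastP_def isUb_def setle_def setge_def)

text \<open>
  Replacing each element of \<open>S\<close> by its join with a fixed \<open>b \<in> S\<close> makes the set bounded below
  without changing its upper bounds, so a bound from above is enough.
\<close>
lemma order_complete_Lub:
  fixes S :: "'a::vector_lattice set"
  assumes oc: "order_complete TYPE('a)" and "S \<noteq> {}" and le: "\<And>a. a \<in> S \<Longrightarrow> a \<le> c"
  obtains s where "isLub UNIV S s"
proof -
  obtain b where b: "b \<in> S" using \<open>S \<noteq> {}\<close> by blast
  have "(\<lambda>a. sup a b) ` S \<subseteq> {b..c}" using le b by auto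
  then obtain s where "isLub UNIV ((\<lambda>a. sup a b) ` S) s"
    using oc b unfolding order_complete_def by (metis empty_iff image_is_empty)
  then have "isLub UNIV S s" using b by (auto simp: isLub_UNIV_iff)
  then show thesis by (rule that)
qed

text \<open>
  This is the infinite distributive law of lattice-ordered groups, in the form of an upper bound
  and up to a translation. It rests on \<open>u + v = sup u v + inf u v\<close>: a bound on \<open>inf (a - x) y\<close>
  bounds \<open>a\<close> itself by a quantity that is monotone in \<open>a\<close>, and this bound survives the passage
  to the supremum. The case of two elements replaces ordinary distributivity below.
\<close>
lemma inf_Lub_diff_le:
  fixes S :: "'a::vector_lattice set"
  assumes s: "isLub UNIV S s" and le: "\<And>a. a \<in> S \<Longrightarrow> inf (a - x) y \<le> w"
  shows "inf (s - x) y \<le> w"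
proof -
  have "a \<le> w + sup (s - x) y - y + x" if a: "a \<in> S" for a
  proof -
    have "a - x + y = sup (a - x) y + inf (a - x) y" by (rule add_eq_inf_sup)
    also have "\<dots> \<le> sup (s - x) y + w"
      using s a le[OF a] by (intro add_mono sup_mono) (auto simp: isLub_UNIV_iff)
    finally show ?thesis by (simp add: algebra_simps)
  qed
  then have "s \<le> w + sup (s - x) y - y + x" using s by (simp add: isLub_UNIV_iff)
  moreover have "s - x + y = sup (s - x) y + inf (s - x) y" by (rule add_eq_inf_sup)
  ultimately show ?thesis by (simp add: algebra_simps)
qed

lemmas inf_Lub_le = inf_Lub_diff_le[where x = 0, simplified]

lemma inf_sup_le:
  fixes a b y w :: "'a::vector_lattice"
  assumes "inf a y \<le> w" "inf b y \<le> w"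
  shows "inf (sup a b) y \<le> w"
  by (rule inf_Lub_le[of "{a, b}"]) (use assms in \<open>auto simp: isLub_UNIV_iff\<close>)

lemma inf_abs_le:
  fixes d y w :: "'a::vector_lattice"
  assumes "inf d y \<le> w" "inf (- d) y \<le> w"
  shows "inf \<bar>d\<bar> y \<le> w"
  unfolding abs_lattice using assms by (rule inf_sup_le)

lemma inf_add_le:
  fixes a b y :: "'a::vector_lattice"
  assumes "0 \<le> a" "0 \<le> b" "0 \<le> y"
  shows "inf (a + b) y \<le> inf a y + inf b y"
proof -
  have "inf (a + b) y \<le> a + b" "inf (a + b) y \<le> a + y" "inf (a + b) y \<le> y + b"
    "inf (a + b) y \<le> y + y"
    using assms by (auto intro: le_infI2 add_increasing add_increasing2)
  then show ?thesis by (simp add: add_inf_distrib_left add_inf_distrib_right)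
qed

text \<open>
  Positive parts contract distances, which lets the limit of a net be found for its positive and
  its negative part separately.
\<close>
lemma abs_pprt_diff_le:
  fixes a b :: "'a::vector_lattice"
  shows "\<bar>pprt a - pprt b\<bar> \<le> \<bar>a - b\<bar>"
proof -
  have le: "pprt u \<le> pprt v + \<bar>u - v\<bar>" for u v :: 'a
  proof -
    have "u = v + (u - v)" by simp
    also have "\<dots> \<le> pprt v + \<bar>u - v\<bar>"
      by (intro add_mono abs_ge_self) (simp add: pprt_def)
    finally show ?thesis by (simp add: pprt_def[of u])
  qed
  show ?thesis
    using le[of a b] le[of b a] by (intro abs_leI) (auto simp: algebra_simps abs_minus_commute)
qed

section \<open>Locally bounded sets in universally complete lattices\<close>

text \<open>
  The hypothesis says that \<open>s\<close> dominates the component of \<open>a\<close> in the band generated by \<open>w\<close>, so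
  the excess of \<open>a\<close> over \<open>s\<close> must live outside that band. To see this without band projections,
  let \<open>t\<close> be the part of the excess that meets \<open>w\<close>. If \<open>n t\<close> is below both \<open>a\<close> and \<open>n w\<close>, it is
  below \<open>s\<close>, and adding one more \<open>t\<close> to \<open>inf a s\<close> does not exceed \<open>a = inf a s + sup (a - s) 0\<close>.
  By induction all multiples of \<open>t\<close> stay below \<open>a\<close>, and \<open>t = 0\<close> by the Archimedean property.
\<close>
lemma multiples_bounded_imp_disjoint:
  fixes a s w :: "'a::archimedean_vector_lattice"
  assumes a: "0 \<le> a" and w: "0 \<le> w"
    and le: "\<And>n::nat. inf a (real n *\<^sub>R w) \<le> s"
  shows "inf (sup (a - s) 0) w = 0"
proof -
  define t where "t = inf (sup (a - s) 0) w"
  have t: "0 \<le> t" "t \<le> sup (a - s) 0" "t \<le> w" using w by (auto simp: t_def)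
  have "real n *\<^sub>R t \<le> inf a (real n *\<^sub>R w)" for n
  proof (induction n)
    case 0
    then show ?case using a by simp
  next
    case (Suc n)
    have "real n *\<^sub>R t \<le> inf a s" using order_trans[OF Suc le[of n]] Suc by simp
    then have "real n *\<^sub>R t + t \<le> inf a s + sup (a - s) 0" using t(2) by (rule add_mono)
    also have "\<dots> = a"
    proof -
      have "sup (a - s) 0 = sup a s - s"
        using add_sup_distrib_right[of a s "- s"] by simp
      moreover have "inf a s = a + s - sup a s"
        using add_eq_inf_sup[of a s] by (simp only: add_diff_cancel_left')
      moreover have "(a + s - u) + (u - s) = a" for u by simp
      ultimately show ?thesis by (simp only:)
    qed
    finally have "real n *\<^sub>R t + t \<le> a" .
    moreover have "real n *\<^sub>R t + t \<le> real n *\<^sub>R w + w" using Suc t(3) by (intro add_mono) auto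
    ultimately show ?case by (simp add: scaleR_left_distrib add.commute)
  qed
  then have "real n *\<^sub>R t \<le> a" for n by simp
  then have "t \<le> 0" by (rule archimedean)
  with t(1) show ?thesis unfolding t_def[symmetric] by (rule antisym[rotated])
qed

text \<open>
  For \<open>w \<ge> 0\<close> and positive \<open>A\<close>, an upper bound of this set is an upper bound of the components of
  the elements of \<open>A\<close> in the band generated by \<open>w\<close>; no band projection has to be constructed.
\<close>
definition truncations :: "'a::vector_lattice set \<Rightarrow> 'a \<Rightarrow> 'a set" where
  "truncations A w = {inf a (real n *\<^sub>R w) | a n. a \<in> A}"

lemma truncationsI: "a \<in> A \<Longrightarrow> inf a (real n *\<^sub>R w) \<in> truncations A w"
  by (auto simp: truncations_def)

lemma inf_scaleR_eq_0:
  fixes v w :: "'a::vector_lattice"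
  assumes "inf v w = 0"
  shows "inf v (real n *\<^sub>R w) = 0"
proof -
  have v: "0 \<le> v" and w: "0 \<le> w" using assms by (metis inf_le1, metis inf_le2)
  show ?thesis
  proof (induction n)
    case 0
    then show ?case using v by (simp add: inf_absorb2)
  next
    case (Suc n)
    have "inf (real n *\<^sub>R w + w) v \<le> inf (real n *\<^sub>R w) v + inf w v"
      using v w by (intro inf_add_le scaleR_nonneg_nonneg) auto
    also have "\<dots> = 0" using Suc assms by (simp add: inf_commute)
    finally have "inf v (real (Suc n) *\<^sub>R w) \<le> 0"
      by (simp add: scaleR_left_distrib add.commute inf_commute)
    then show ?case using v w by (intro antisym) (auto intro: scaleR_nonneg_nonneg)
  qed
qed

text \<open>
  This is where lateral completeness enters. Zorn's lemma gives a maximal disjoint set \<open>W\<close> of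
  positive elements on whose bands \<open>A\<close> is bounded. The suprema \<open>g w\<close> of the components of \<open>A\<close> in
  these bands are disjoint, hence have a supremum \<open>s\<close>. If some \<open>a \<in> A\<close> were not below \<open>s\<close>, then
  the excess \<open>sup (a - s) 0\<close> would be disjoint from all of \<open>W\<close>, yet it would dominate a further
  element on whose band \<open>A\<close> is bounded, which contradicts maximality.
\<close>
lemma locally_bounded_imp_bounded:
  fixes A :: "'u::archimedean_vector_lattice set"
  assumes uc: "universally_complete TYPE('u)"
    and A: "A \<noteq> {}" "\<And>a. a \<in> A \<Longrightarrow> 0 \<le> a"
    and local: "\<And>v. 0 < v \<Longrightarrow> \<exists>w c. 0 < w \<and> w \<le> v \<and> (\<forall>b\<in>truncations A w. b \<le> c)"
  obtains s where "\<And>a. a \<in> A \<Longrightarrow> a \<le> s"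
proof -
  have oc: "order_complete TYPE('u)" and lc: "laterally_complete TYPE('u)"
    using uc by (auto simp: universally_complete_def)
  define G where "G = {w. 0 < w \<and> (\<exists>c. \<forall>b\<in>truncations A w. b \<le> c)}"
  define F where "F = {W. W \<subseteq> G \<and> pairwise (\<lambda>v w. inf v w = 0) W}"
  have "\<exists>W\<in>F. \<forall>V\<in>F. W \<subseteq> V \<longrightarrow> V = W"
  proof (rule subset_Zorn')
    fix C assume C: "subset.chain F C"
    have "pairwise (\<lambda>v w. inf v w = 0) (\<Union>C)"
    proof (rule pairwise_chain_Union)
      show "pairwise (\<lambda>v w. inf v w = 0) S" if "S \<in> C" for S
        using C that by (auto simp: F_def subset.chain_def)
      show "chain\<^sub>\<subseteq> C" using C by (auto simp: chain_subset_def subset.chain_def)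
    qed
    then show "\<Union>C \<in> F" using C by (auto simp: F_def subset.chain_def)
  qed
  then obtain W where "W \<in> F" and Wmax: "\<And>V. V \<in> F \<Longrightarrow> W \<subseteq> V \<Longrightarrow> V = W"
    by metis
  then have WG: "W \<subseteq> G" and Wd: "pairwise (\<lambda>v w. inf v w = 0) W"
    by (simp_all add: F_def)
  have trunc_nonneg: "0 \<le> b" if "b \<in> truncations A w" "w \<in> W" for b w
  proof -
    have "0 \<le> w" using that WG by (auto simp: G_def)
    then show ?thesis using that A(2)
      by (auto simp: truncations_def intro!: le_infI scaleR_nonneg_nonneg)
  qed
  have "\<exists>s. isLub UNIV (truncations A w) s" if w: "w \<in> W" for w
  proof -
    obtain c where c: "\<forall>b\<in>truncations A w. b \<le> c" using w WG by (auto simp: G_def)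
    have "truncations A w \<noteq> {}" using A(1) by (auto simp: truncations_def)
    with oc trunc_nonneg[OF _ w] c show ?thesis
      by (meson order_complete_Lub)
  qed
  then obtain g where g: "\<And>w. w \<in> W \<Longrightarrow> isLub UNIV (truncations A w) (g w)" by metis
  have g_nonneg: "0 \<le> g w" if w: "w \<in> W" for w
  proof -
    obtain a where "a \<in> A" using A(1) by blast
    then have "inf a (real 0 *\<^sub>R w) \<in> truncations A w" by (rule truncationsI)
    then have "0 \<le> inf a (real 0 *\<^sub>R w)" "inf a (real 0 *\<^sub>R w) \<le> g w"
      using g[OF w] trunc_nonneg[OF _ w] unfolding isLub_UNIV_iff by blast+
    then show ?thesis by (rule order_trans)
  qed
  have g_disjoint: "inf (g w) z = 0" if w: "w \<in> W" and z: "inf z w = 0" for w z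
  proof -
    have z0: "0 \<le> z" using z by (metis inf_le1)
    have "inf (g w) z \<le> 0"
    proof (rule inf_Lub_le[OF g[OF w]])
      fix b assume "b \<in> truncations A w"
      then obtain a n where b: "b = inf a (real n *\<^sub>R w)"
        unfolding truncations_def by blast
      have "inf b z \<le> inf z (real n *\<^sub>R w)" unfolding b by (auto intro: le_infI1)
      then show "inf b z \<le> 0" by (simp add: inf_scaleR_eq_0[OF z])
    qed
    then show ?thesis using z0 g_nonneg[OF w] by (intro antisym) auto
  qed
  \<comment> \<open>Adjoining \<open>0\<close> keeps the disjoint set nonempty when \<open>W\<close> is empty.\<close>
  have "pairwise (\<lambda>x y. inf \<bar>x\<bar> \<bar>y\<bar> = 0) (insert 0 (g ` W))"
  proof -
    have "inf (g v) (g w) = 0" if "v \<in> W" "w \<in> W" "g v \<noteq> g w" for v w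
    proof (rule g_disjoint[OF that(1)])
      have "inf v w = 0" using that Wd by (auto simp: pairwise_def)
      then show "inf (g w) v = 0" using that by (intro g_disjoint)
    qed
    then show ?thesis using g_nonneg
      by (auto simp: pairwise_def abs_of_nonneg inf_absorb1 inf_absorb2)
  qed
  then obtain s where s: "isLub UNIV (insert 0 (g ` W)) s"
    using lc g_nonneg unfolding laterally_complete_def by force
  have "a \<le> s" if a: "a \<in> A" for a
  proof -
    have disj: "inf (sup (a - s) 0) w = 0" if w: "w \<in> W" for w
    proof (rule multiples_bounded_imp_disjoint)
      show "0 \<le> a" using A(2) a .
      show "0 \<le> w" using w WG by (auto simp: G_def)
      fix n :: nat
      have "inf a (real n *\<^sub>R w) \<le> g w"
        using g[OF w] truncationsI[OF a] by (auto simp: isLub_UNIV_iff)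
      also have "\<dots> \<le> s" using s w by (auto simp: isLub_UNIV_iff)
      finally show "inf a (real n *\<^sub>R w) \<le> s" .
    qed
    have "sup (a - s) 0 = 0"
    proof (rule ccontr)
      assume "sup (a - s) 0 \<noteq> 0"
      then have "0 < sup (a - s) 0" by (simp add: order_less_le)
      then obtain v c where v: "0 < v" "v \<le> sup (a - s) 0" "\<forall>b\<in>truncations A v. b \<le> c"
        using local by blast
      have vW: "inf v w = 0" if "w \<in> W" for w
      proof (rule antisym)
        show "inf v w \<le> 0" using disj[OF that] v(2) by (metis inf_mono order_refl)
        show "0 \<le> inf v w" using v(1) that WG by (auto simp: G_def)
      qed
      have "insert v W \<in> F"
        using WG Wd vW v(1,3) unfolding F_def G_def
        by (auto simp: pairwise_insert inf_commute)
      then have "v \<in> W" using Wmax by blast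
      with vW[of v] v(1) show False by simp
    qed
    then show ?thesis by (metis diff_le_0_iff_le sup_ge1)
  qed
  then show thesis by (rule that)
qed

section \<open>Uo-Cauchy nets and order dense sublattices\<close>

text \<open>
  A form of the uo-Cauchy property that does not mention order convergence: the truncated
  oscillation of a tail stays away from the truncating element \<open>v\<close> by some \<open>z > 0\<close>. The tail and
  \<open>z\<close> depend on \<open>v\<close>. Unlike a dominating net, this transfers easily from an order dense sublattice
  to the whole lattice.
\<close>
definition locally_Cauchy ::
    "'i set \<Rightarrow> ('i \<Rightarrow> 'i \<Rightarrow> bool) \<Rightarrow> ('i \<Rightarrow> 'a::vector_lattice) \<Rightarrow> bool" where
  "locally_Cauchy \<Gamma> le x \<longleftrightarrow> (\<forall>v>0. \<exists>\<beta>\<in>\<Gamma>. \<exists>z>0. \<forall>\<alpha>\<in>\<Gamma>. \<forall>\<alpha>'\<in>\<Gamma>.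
     le \<beta> \<alpha> \<longrightarrow> le \<beta> \<alpha>' \<longrightarrow> inf \<bar>x \<alpha> - x \<alpha>'\<bar> v \<le> v - z)"

text \<open>
  Below a given \<open>v > 0\<close> there is some \<open>J y > 0\<close>. As \<open>y\<close> is not a lower bound of the net \<open>a\<close> that
  dominates the oscillation truncated at \<open>y\<close>, some \<open>inf y (a \<gamma>)\<close> falls short of \<open>y\<close> by an element
  \<open>z > 0\<close>. Raising the truncation level from \<open>J y\<close> to \<open>v\<close> increases the truncated oscillation by
  at most \<open>v - J y\<close>, so the gap \<open>J z\<close> persists.
\<close>
lemma uo_Cauchy_imp_locally_Cauchy:
  fixes J :: "'a::vector_lattice \<Rightarrow> 'u::vector_lattice"
  assumes J: "lattice_embedding J" and dense: "order_dense (range J)"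
    and dir: "directed \<Gamma> le" and cau: "uo_Cauchy \<Gamma> le x"
  shows "locally_Cauchy \<Gamma> le (\<lambda>\<alpha>. J (x \<alpha>))"
  unfolding locally_Cauchy_def
proof (intro allI impI)
  have lin: "linear J" and Jinf: "\<And>x y. J (inf x y) = inf (J x) (J y)"
    and Jsup: "\<And>x y. J (sup x y) = sup (J x) (J y)" and inj: "inj J"
    using J by (auto simp: lattice_embedding_def)
  have J0: "J 0 = 0" using lin by (rule linear_0)
  have Jle: "J a \<le> J b \<longleftrightarrow> a \<le> b" for a b
    using Jinf[of a b] inj by (metis injD le_iff_inf)
  have Jabs: "J \<bar>a\<bar> = \<bar>J a\<bar>" for a
    by (simp add: abs_lattice Jsup linear_neg[OF lin])
  have Jpos: "0 < J a \<longleftrightarrow> 0 < a" for a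
    using Jle[of 0 a] Jle[of a 0] by (simp add: J0 less_le_not_le)
  fix v :: 'u assume "0 < v"
  then obtain y where y: "0 < y" "J y \<le> v"
    using dense unfolding order_dense_def by (metis Jpos rangeE)
  have "order_converges (\<Gamma> \<times> \<Gamma>) (rel_prod le le)
      (\<lambda>p. inf \<bar>(case p of (\<alpha>, \<alpha>') \<Rightarrow> x \<alpha> - x \<alpha>') - 0\<bar> y) 0"
    using cau y(1) unfolding uo_Cauchy_def uo_converges_def by simp
  then obtain \<Lambda> :: "'a set" and le' a where dec: "decreases_to_zero \<Lambda> le' a"
    and dom: "\<And>\<gamma>. \<gamma> \<in> \<Lambda> \<Longrightarrow> \<exists>p\<in>\<Gamma> \<times> \<Gamma>. \<forall>q\<in>\<Gamma> \<times> \<Gamma>. rel_prod le le p q \<longrightarrow>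
      \<bar>inf \<bar>(case q of (\<alpha>, \<alpha>') \<Rightarrow> x \<alpha> - x \<alpha>') - 0\<bar> y - 0\<bar> \<le> a \<gamma>"
    unfolding order_converges_def by blast
  have "\<not> (\<forall>\<gamma>\<in>\<Lambda>. y \<le> a \<gamma>)"
    using dec y(1) by (auto simp: decreases_to_zero_def isGlb_UNIV_iff)
  then obtain \<gamma> where \<gamma>: "\<gamma> \<in> \<Lambda>" "\<not> y \<le> a \<gamma>" by blast
  obtain \<beta>1 \<beta>2 where \<beta>12: "\<beta>1 \<in> \<Gamma>" "\<beta>2 \<in> \<Gamma>"
    and tail: "\<And>\<alpha> \<alpha>'. \<alpha> \<in> \<Gamma> \<Longrightarrow> \<alpha>' \<in> \<Gamma> \<Longrightarrow> le \<beta>1 \<alpha> \<Longrightarrow> le \<beta>2 \<alpha>' \<Longrightarrow>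
      \<bar>inf \<bar>x \<alpha> - x \<alpha>'\<bar> y\<bar> \<le> a \<gamma>"
    using dom[OF \<gamma>(1)] by fastforce
  obtain \<beta> where \<beta>: "\<beta> \<in> \<Gamma>" "le \<beta>1 \<beta>" "le \<beta>2 \<beta>"
    using dir \<beta>12 unfolding directed_def by blast
  have trans: "le \<beta>1 \<alpha>" "le \<beta>2 \<alpha>" if "\<alpha> \<in> \<Gamma>" "le \<beta> \<alpha>" for \<alpha>
    using dir \<beta>12 \<beta> that unfolding directed_def by (meson transp_onD)+
  define z where "z = y - inf y (a \<gamma>)"
  have "inf y (a \<gamma>) \<noteq> y" using \<gamma>(2) by (metis inf_le2)
  then have "inf y (a \<gamma>) < y" by (simp add: order_less_le)
  then have z: "0 < z" by (simp only: z_def diff_gt_0_iff_gt)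
  have "inf \<bar>J (x \<alpha>) - J (x \<alpha>')\<bar> v \<le> v - J z"
    if \<alpha>: "\<alpha> \<in> \<Gamma>" "\<alpha>' \<in> \<Gamma>" "le \<beta> \<alpha>" "le \<beta> \<alpha>'" for \<alpha> \<alpha>'
  proof -
    have "inf \<bar>x \<alpha> - x \<alpha>'\<bar> y \<le> inf y (a \<gamma>)"
      using tail[of \<alpha> \<alpha>'] trans \<alpha> by (auto intro: order_trans[OF abs_ge_self])
    then have "J (inf \<bar>x \<alpha> - x \<alpha>'\<bar> y) \<le> J (y - z)" by (simp add: Jle z_def)
    then have *: "inf \<bar>J (x \<alpha>) - J (x \<alpha>')\<bar> (J y) \<le> J y - J z"
      by (simp add: Jinf Jabs linear_diff[OF lin])
    have "inf \<bar>J (x \<alpha>) - J (x \<alpha>')\<bar> v - (v - J y) \<le> inf \<bar>J (x \<alpha>) - J (x \<alpha>')\<bar> (J y)"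
      using y(2) by (intro le_infI) (auto simp: algebra_simps intro: add_mono)
    also note *
    finally show ?thesis by (simp add: algebra_simps)
  qed
  then show "\<exists>\<beta>\<in>\<Gamma>. \<exists>z>0. \<forall>\<alpha>\<in>\<Gamma>. \<forall>\<alpha>'\<in>\<Gamma>. le \<beta> \<alpha> \<longrightarrow> le \<beta> \<alpha>' \<longrightarrow>
      inf \<bar>J (x \<alpha>) - J (x \<alpha>')\<bar> v \<le> v - z"
    using \<beta>(1) z by (intro bexI[of _ \<beta>] exI[of _ "J z"]) (auto simp: Jpos)
qed

lemma locally_Cauchy_contraction:
  assumes "locally_Cauchy \<Gamma> le x"
    and "\<And>\<alpha> \<alpha>'. \<bar>p \<alpha> - p \<alpha>'\<bar> \<le> \<bar>x \<alpha> - x \<alpha>'\<bar>"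
  shows "locally_Cauchy \<Gamma> le p"
proof -
  have "inf \<bar>p \<alpha> - p \<alpha>'\<bar> v \<le> c" if "inf \<bar>x \<alpha> - x \<alpha>'\<bar> v \<le> c" for \<alpha> \<alpha>' v c
    using inf_mono[OF assms(2) order_refl] that by (rule order_trans)
  then show ?thesis using assms(1) unfolding locally_Cauchy_def by blast
qed

section \<open>Limits of locally Cauchy nets\<close>
definition oscillations ::
    "'i set \<Rightarrow> ('i \<Rightarrow> 'i \<Rightarrow> bool) \<Rightarrow> ('i \<Rightarrow> 'a::vector_lattice) \<Rightarrow> 'a \<Rightarrow> 'i \<Rightarrow> 'a set" where
  "oscillations \<Gamma> le x y \<beta> =
     {inf \<bar>x \<alpha> - x \<alpha>'\<bar> y | \<alpha> \<alpha>'. \<alpha> \<in> \<Gamma> \<and> \<alpha>' \<in> \<Gamma> \<and> le \<beta> \<alpha> \<and> le \<beta> \<alpha>'}"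

text \<open>
  The suprema \<open>w \<beta>\<close> of the truncated oscillations of the tails decrease. They have infimum \<open>0\<close>:
  a positive lower bound \<open>v\<close> would, by the infinite distributive law, be the supremum of the
  oscillations of a tail truncated at \<open>v\<close>, and these stay away from \<open>v\<close> if the tail is chosen
  according to the local Cauchy condition.
\<close>
lemma oscillation_bound:
  fixes x :: "'i \<Rightarrow> 'u::vector_lattice"
  assumes oc: "order_complete TYPE('u)" and dir: "directed \<Gamma> le"
    and cau: "locally_Cauchy \<Gamma> le x" and y: "0 \<le> y"
  obtains w where "decreases_to_zero \<Gamma> le w"
    and "\<And>\<beta> \<alpha> \<alpha>'. \<beta> \<in> \<Gamma> \<Longrightarrow> \<alpha> \<in> \<Gamma> \<Longrightarrow> \<alpha>' \<in> \<Gamma> \<Longrightarrow> le \<beta> \<alpha> \<Longrightarrow> le \<beta> \<alpha>' \<Longrightarrow>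
      inf \<bar>x \<alpha> - x \<alpha>'\<bar> y \<le> w \<beta>"
proof -
  have refl: "le \<beta> \<beta>" if "\<beta> \<in> \<Gamma>" for \<beta>
    using dir that by (auto simp: directed_def dest: reflp_onD)
  have trans: "le \<alpha> \<gamma>" if "\<alpha> \<in> \<Gamma>" "\<beta> \<in> \<Gamma>" "\<gamma> \<in> \<Gamma>" "le \<alpha> \<beta>" "le \<beta> \<gamma>" for \<alpha> \<beta> \<gamma>
    using dir that unfolding directed_def by (meson transp_onD)
  have "\<exists>s. isLub UNIV (oscillations \<Gamma> le x y \<beta>) s" if \<beta>: "\<beta> \<in> \<Gamma>" for \<beta>
  proof -
    have "oscillations \<Gamma> le x y \<beta> \<noteq> {}"
      using \<beta> refl[OF \<beta>] unfolding oscillations_def by blast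
    moreover have "0 \<le> b" "b \<le> y" if "b \<in> oscillations \<Gamma> le x y \<beta>" for b
      using that y by (auto simp: oscillations_def)
    ultimately show ?thesis using order_complete_Lub[OF oc] by metis
  qed
  then obtain w where w: "\<And>\<beta>. \<beta> \<in> \<Gamma> \<Longrightarrow> isLub UNIV (oscillations \<Gamma> le x y \<beta>) (w \<beta>)" by metis
  have bound: "inf \<bar>x \<alpha> - x \<alpha>'\<bar> y \<le> w \<beta>"
    if "\<beta> \<in> \<Gamma>" "\<alpha> \<in> \<Gamma>" "\<alpha>' \<in> \<Gamma>" "le \<beta> \<alpha>" "le \<beta> \<alpha>'" for \<beta> \<alpha> \<alpha>'
    using w[OF that(1)] that unfolding isLub_UNIV_iff oscillations_def by blast
  have "decreases_to_zero \<Gamma> le w"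
    unfolding decreases_to_zero_def isGlb_UNIV_iff
  proof (intro conjI dir ballI allI impI)
    fix \<alpha> \<beta> assume \<alpha>\<beta>: "\<alpha> \<in> \<Gamma>" "\<beta> \<in> \<Gamma>" "le \<alpha> \<beta>"
    then have "oscillations \<Gamma> le x y \<beta> \<subseteq> oscillations \<Gamma> le x y \<alpha>"
      using trans unfolding oscillations_def by blast
    then show "w \<beta> \<le> w \<alpha>" using w \<alpha>\<beta> unfolding isLub_UNIV_iff by blast
  next
    fix c assume "c \<in> w ` \<Gamma>"
    then obtain \<beta> where "\<beta> \<in> \<Gamma>" "c = w \<beta>" by blast
    with bound[of \<beta> \<beta> \<beta>] refl y show "0 \<le> c" by (simp add: inf_absorb1)
  next
    fix c assume c: "\<forall>b\<in>w ` \<Gamma>. c \<le> b"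
    show "c \<le> 0"
    proof (rule ccontr)
      assume "\<not> c \<le> 0"
      define v where "v = sup c 0"
      have "v \<noteq> 0" using \<open>\<not> c \<le> 0\<close> by (metis sup_ge1 v_def)
      then have v: "0 < v" by (simp add: v_def order_less_le)
      then obtain \<beta> z where \<beta>: "\<beta> \<in> \<Gamma>" and z: "0 < z"
        and tail: "\<And>\<alpha> \<alpha>'. \<alpha> \<in> \<Gamma> \<Longrightarrow> \<alpha>' \<in> \<Gamma> \<Longrightarrow> le \<beta> \<alpha> \<Longrightarrow> le \<beta> \<alpha>' \<Longrightarrow>
          inf \<bar>x \<alpha> - x \<alpha>'\<bar> v \<le> v - z"
        using cau unfolding locally_Cauchy_def by blast
      have "0 \<le> w \<beta>" using bound[of \<beta> \<beta> \<beta>] refl \<beta> y by (simp add: inf_absorb1)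
      then have vw: "v \<le> w \<beta>" using c \<beta> by (simp add: v_def)
      have "inf (w \<beta>) v \<le> v - z"
      proof (rule inf_Lub_le[OF w[OF \<beta>]])
        fix b assume "b \<in> oscillations \<Gamma> le x y \<beta>"
        then obtain \<alpha> \<alpha>' where \<alpha>: "b = inf \<bar>x \<alpha> - x \<alpha>'\<bar> y" "\<alpha> \<in> \<Gamma>" "\<alpha>' \<in> \<Gamma>" "le \<beta> \<alpha>" "le \<beta> \<alpha>'"
          by (auto simp: oscillations_def)
        have "inf b v \<le> inf \<bar>x \<alpha> - x \<alpha>'\<bar> v" unfolding \<alpha>(1) by (auto intro: le_infI1)
        also have "\<dots> \<le> v - z" using \<alpha> by (intro tail)
        finally show "inf b v \<le> v - z" .
      qed
      with vw have "v \<le> v - z" by (simp add: inf_absorb2)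
      with z show False by simp
    qed
  qed
  then show thesis using bound by (rule that)
qed

text \<open>
  The limit is the lower limit of the net, that is, the supremum of the set \<open>A\<close> of its eventual
  positive lower bounds. The point is that \<open>A\<close> is bounded above. By the local Cauchy condition
  every \<open>v > 0\<close> has some \<open>z > 0\<close> and a tail, starting at \<open>\<beta>\<close>, in which the distances exceed \<open>v\<close>
  only outside the band generated by \<open>z\<close>; on this band all elements of \<open>A\<close> are therefore below
  \<open>p \<beta> + v\<close>.

  The conclusion says that the distance from the net to the limit obeys every bound that the
  truncated oscillation of the tail obeys. It is stated for an arbitrary bound so that the
  positive and negative parts of a net can share the bound obtained from the net itself.
\<close>
lemma positive_locally_Cauchy_limit:
  fixes p :: "'i \<Rightarrow> 'u::archimedean_vector_lattice"
  assumes uc: "universally_complete TYPE('u)" and dir: "directed \<Gamma> le"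
    and cau: "locally_Cauchy \<Gamma> le p" and pos: "\<And>\<alpha>. 0 \<le> p \<alpha>"
  obtains l where "\<And>y w \<beta> \<alpha>. \<beta> \<in> \<Gamma> \<Longrightarrow> \<alpha> \<in> \<Gamma> \<Longrightarrow> le \<beta> \<alpha> \<Longrightarrow>
      (\<And>\<alpha> \<alpha>'. \<alpha> \<in> \<Gamma> \<Longrightarrow> \<alpha>' \<in> \<Gamma> \<Longrightarrow> le \<beta> \<alpha> \<Longrightarrow> le \<beta> \<alpha>' \<Longrightarrow> inf \<bar>p \<alpha> - p \<alpha>'\<bar> y \<le> w) \<Longrightarrow>
      inf \<bar>p \<alpha> - l\<bar> y \<le> w"
proof -
  have oc: "order_complete TYPE('u)" using uc by (simp add: universally_complete_def)
  have above: "\<exists>\<alpha>'\<in>\<Gamma>. le \<beta> \<alpha>' \<and> le \<gamma> \<alpha>'" if "\<beta> \<in> \<Gamma>" "\<gamma> \<in> \<Gamma>" for \<beta> \<gamma>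
    using dir that unfolding directed_def by blast
  define A where "A = {a. 0 \<le> a \<and> (\<exists>\<gamma>\<in>\<Gamma>. \<forall>\<alpha>\<in>\<Gamma>. le \<gamma> \<alpha> \<longrightarrow> a \<le> p \<alpha>)}"
  have A0: "0 \<in> A" using dir pos by (auto simp: A_def directed_def)
  have A_above: "\<exists>\<alpha>'\<in>\<Gamma>. le \<beta> \<alpha>' \<and> a \<le> p \<alpha>'" if "a \<in> A" "\<beta> \<in> \<Gamma>" for a \<beta>
    using above that unfolding A_def by blast
  obtain c where c: "\<And>a. a \<in> A \<Longrightarrow> a \<le> c"
  proof (rule locally_bounded_imp_bounded[OF uc, of A])
    show "A \<noteq> {}" using A0 by blast
    show "0 \<le> a" if "a \<in> A" for a using that by (simp add: A_def)
    fix v :: 'u assume v: "0 < v"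
    then obtain \<beta> z where \<beta>: "\<beta> \<in> \<Gamma>" and z: "0 < z"
      and tail: "\<And>\<alpha> \<alpha>'. \<alpha> \<in> \<Gamma> \<Longrightarrow> \<alpha>' \<in> \<Gamma> \<Longrightarrow> le \<beta> \<alpha> \<Longrightarrow> le \<beta> \<alpha>' \<Longrightarrow>
        inf \<bar>p \<alpha> - p \<alpha>'\<bar> v \<le> v - z"
      using cau unfolding locally_Cauchy_def by blast
    have le\<beta>: "le \<beta> \<beta>" using dir \<beta> by (auto simp: directed_def dest: reflp_onD)
    have zv: "z \<le> v" using tail[OF \<beta> \<beta> le\<beta> le\<beta>] v by (simp add: inf_absorb1)
    have "b \<le> p \<beta> + v" if b_trunc: "b \<in> truncations A z" for b
    proof -
      obtain a n where a: "a \<in> A" and b: "b = inf a (real n *\<^sub>R z)"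
        using b_trunc unfolding truncations_def by blast
      obtain \<alpha> where \<alpha>: "\<alpha> \<in> \<Gamma>" "le \<beta> \<alpha>" "a \<le> p \<alpha>" using A_above[OF a \<beta>] by blast
      \<comment> \<open>\<open>e = sup (d - v) 0\<close> is the part of the distance above \<open>v\<close>; it is disjoint from \<open>z\<close>.\<close>
      define d where "d = \<bar>p \<alpha> - p \<beta>\<bar>"
      define i where "i = inf d v"
      define e where "e = d - i"
      have i: "i \<le> d" "i \<le> v" by (simp_all add: i_def)
      have e0: "0 \<le> e" using i(1) by (simp add: e_def)
      have "i \<le> v - z" unfolding i_def d_def using \<alpha> \<beta> le\<beta> by (intro tail)
      then have "z \<le> v - i" by (simp add: algebra_simps)
      then have "inf e z \<le> inf (d - i) (v - i)"
        unfolding e_def by (auto intro: le_infI2)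
      also have "\<dots> = inf d v - i"
        unfolding diff_conv_add_uminus by (rule add_inf_distrib_right[symmetric])
      also have "\<dots> = 0" by (simp only: i_def diff_self)
      finally have "inf e z = 0" using e0 z by (intro antisym) auto
      then have ez: "inf e (real n *\<^sub>R z) = 0" by (rule inf_scaleR_eq_0)
      have "p \<alpha> \<le> p \<beta> + d" unfolding d_def by (metis abs_ge_self diff_le_eq add.commute)
      also have "\<dots> \<le> p \<beta> + v + e" unfolding e_def using i(2) by (simp add: algebra_simps)
      finally have "b \<le> inf (p \<beta> + v + e) (real n *\<^sub>R z)"
        unfolding b using \<alpha>(3) by (intro inf_mono) auto
      also have "\<dots> \<le> inf (p \<beta> + v) (real n *\<^sub>R z) + inf e (real n *\<^sub>R z)"
        using pos[of \<beta>] v z e0 by (intro inf_add_le scaleR_nonneg_nonneg add_nonneg_nonneg) auto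
      also have "\<dots> \<le> p \<beta> + v" by (simp add: ez)
      finally show ?thesis .
    qed
    then show "\<exists>w c. 0 < w \<and> w \<le> v \<and> (\<forall>b\<in>truncations A w. b \<le> c)" using z zv by blast
  qed blast
  have "A \<noteq> {}" using A0 by blast
  then obtain l where l: "isLub UNIV A l" using order_complete_Lub[OF oc _ c] by metis
  show thesis
  proof (rule that)
    fix y w :: 'u and \<beta> \<alpha>
    assume \<beta>: "\<beta> \<in> \<Gamma>" and \<alpha>: "\<alpha> \<in> \<Gamma>" "le \<beta> \<alpha>"
      and tail: "\<And>\<alpha> \<alpha>'. \<alpha> \<in> \<Gamma> \<Longrightarrow> \<alpha>' \<in> \<Gamma> \<Longrightarrow> le \<beta> \<alpha> \<Longrightarrow> le \<beta> \<alpha>' \<Longrightarrow>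
        inf \<bar>p \<alpha> - p \<alpha>'\<bar> y \<le> w"
    show "inf \<bar>p \<alpha> - l\<bar> y \<le> w"
    proof (rule inf_abs_le)
      have "inf (l - p \<alpha>) y \<le> w"
      proof (rule inf_Lub_diff_le[OF l])
        fix a assume "a \<in> A"
        then obtain \<alpha>' where \<alpha>': "\<alpha>' \<in> \<Gamma>" "le \<beta> \<alpha>'" "a \<le> p \<alpha>'" using A_above \<beta> by blast
        have "a - p \<alpha> \<le> \<bar>p \<alpha>' - p \<alpha>\<bar>"
          using \<alpha>'(3) by (intro order_trans[OF _ abs_ge_self]) simp
        then have "inf (a - p \<alpha>) y \<le> inf \<bar>p \<alpha>' - p \<alpha>\<bar> y" by (rule inf_mono) simp
        also have "\<dots> \<le> w" using \<alpha> \<alpha>' by (intro tail)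
        finally show "inf (a - p \<alpha>) y \<le> w" .
      qed
      then show "inf (- (p \<alpha> - l)) y \<le> w" by simp
    next
      \<comment> \<open>\<open>- m\<close> is the infimum of the tail starting at \<open>\<beta>\<close>, an eventual lower bound of the net.\<close>
      define T where "T = (\<lambda>\<alpha>'. - p \<alpha>') ` {\<alpha>'\<in>\<Gamma>. le \<beta> \<alpha>'}"
      have "T \<noteq> {}" "\<And>b. b \<in> T \<Longrightarrow> b \<le> 0" using \<alpha> pos by (auto simp: T_def)
      then obtain m where m: "isLub UNIV T m"
        using order_complete_Lub[OF oc] by metis
      have "- m \<in> A"
        unfolding A_def
      proof (intro CollectI conjI bexI[OF _ \<beta>] ballI impI)
        have "m \<le> 0" using m pos by (auto simp: isLub_UNIV_iff T_def)
        then show "0 \<le> - m" by simp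
        fix \<alpha>' assume "\<alpha>' \<in> \<Gamma>" "le \<beta> \<alpha>'"
        then have "- p \<alpha>' \<le> m" using m by (auto simp: isLub_UNIV_iff T_def)
        then show "- m \<le> p \<alpha>'" by (simp add: minus_le_iff)
      qed
      then have "- m \<le> l" using l by (simp add: isLub_UNIV_iff)
      then have "- l \<le> m" by (simp add: minus_le_iff)
      then have "p \<alpha> + - l \<le> p \<alpha> + m" by (rule add_left_mono)
      then have "p \<alpha> - l \<le> m - (- p \<alpha>)" by (simp add: algebra_simps)
      then have "inf (p \<alpha> - l) y \<le> inf (m - (- p \<alpha>)) y" by (rule inf_mono) simp
      also have "\<dots> \<le> w"
      proof (rule inf_Lub_diff_le[OF m])
        fix b assume "b \<in> T"
        then obtain \<alpha>' where \<alpha>': "b = - p \<alpha>'" "\<alpha>' \<in> \<Gamma>" "le \<beta> \<alpha>'" by (auto simp: T_def)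
        have "b - (- p \<alpha>) \<le> \<bar>p \<alpha> - p \<alpha>'\<bar>" unfolding \<alpha>'(1)
          by (intro order_trans[OF _ abs_ge_self]) simp
        then have "inf (b - (- p \<alpha>)) y \<le> inf \<bar>p \<alpha> - p \<alpha>'\<bar> y" by (rule inf_mono) simp
        also have "\<dots> \<le> w" using \<alpha> \<alpha>' by (intro tail)
        finally show "inf (b - (- p \<alpha>)) y \<le> w" .
      qed
      finally show "inf (p \<alpha> - l) y \<le> w" .
    qed
  qed
qed

lemma decreases_to_zero_double:
  fixes w :: "'i \<Rightarrow> 'a::vector_lattice"
  assumes "decreases_to_zero \<Gamma> le w"
  shows "decreases_to_zero \<Gamma> le (\<lambda>\<beta>. w \<beta> + w \<beta>)"
proof -
  have half: "c \<le> a + a \<longleftrightarrow> (1/2) *\<^sub>R c \<le> a" for a c :: 'a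
  proof
    assume "c \<le> a + a"
    then have "(1/2) *\<^sub>R c \<le> (1/2) *\<^sub>R (a + a)" by (rule scaleR_left_mono) simp
    then show "(1/2) *\<^sub>R c \<le> a" by (simp add: scaleR_right_distrib flip: scaleR_left_distrib)
  next
    assume "(1/2) *\<^sub>R c \<le> a"
    then have "(1/2) *\<^sub>R c + (1/2) *\<^sub>R c \<le> a + a" by (intro add_mono)
    then show "c \<le> a + a" by (simp flip: scaleR_left_distrib)
  qed
  have half0: "(1/2) *\<^sub>R c \<le> 0 \<Longrightarrow> c \<le> 0" for c :: 'a using half[of c 0] by simp
  show ?thesis
    using assms unfolding decreases_to_zero_def isGlb_UNIV_iff
    by (auto intro: add_mono simp: half half0)
qed

lemma locally_Cauchy_uo_converges:
  fixes x :: "'i \<Rightarrow> 'u::archimedean_vector_lattice"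
  assumes uc: "universally_complete TYPE('u)" and dir: "directed \<Gamma> le"
    and cau: "locally_Cauchy \<Gamma> le x"
  obtains l where "uo_converges \<Gamma> le x l"
proof -
  have oc: "order_complete TYPE('u)" using uc by (simp add: universally_complete_def)
  define p where "p \<alpha> = pprt (x \<alpha>)" for \<alpha>
  define n where "n \<alpha> = pprt (- x \<alpha>)" for \<alpha>
  have x: "x \<alpha> = p \<alpha> - n \<alpha>" for \<alpha>
    using prts[of "x \<alpha>"] by (simp add: p_def n_def pprt_neg)
  have p: "\<bar>p \<alpha> - p \<alpha>'\<bar> \<le> \<bar>x \<alpha> - x \<alpha>'\<bar>" for \<alpha> \<alpha>'
    unfolding p_def by (rule abs_pprt_diff_le)
  have n: "\<bar>n \<alpha> - n \<alpha>'\<bar> \<le> \<bar>x \<alpha> - x \<alpha>'\<bar>" for \<alpha> \<alpha>'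
    using abs_pprt_diff_le[of "- x \<alpha>" "- x \<alpha>'"] by (simp add: n_def abs_minus_commute)
  obtain lp where lp: "\<And>y w \<beta> \<alpha>. \<beta> \<in> \<Gamma> \<Longrightarrow> \<alpha> \<in> \<Gamma> \<Longrightarrow> le \<beta> \<alpha> \<Longrightarrow>
      (\<And>\<alpha> \<alpha>'. \<alpha> \<in> \<Gamma> \<Longrightarrow> \<alpha>' \<in> \<Gamma> \<Longrightarrow> le \<beta> \<alpha> \<Longrightarrow> le \<beta> \<alpha>' \<Longrightarrow> inf \<bar>p \<alpha> - p \<alpha>'\<bar> y \<le> w) \<Longrightarrow>
      inf \<bar>p \<alpha> - lp\<bar> y \<le> w"
    using positive_locally_Cauchy_limit[OF uc dir locally_Cauchy_contraction[OF cau p]]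
    by (auto simp: p_def)
  obtain ln where ln: "\<And>y w \<beta> \<alpha>. \<beta> \<in> \<Gamma> \<Longrightarrow> \<alpha> \<in> \<Gamma> \<Longrightarrow> le \<beta> \<alpha> \<Longrightarrow>
      (\<And>\<alpha> \<alpha>'. \<alpha> \<in> \<Gamma> \<Longrightarrow> \<alpha>' \<in> \<Gamma> \<Longrightarrow> le \<beta> \<alpha> \<Longrightarrow> le \<beta> \<alpha>' \<Longrightarrow> inf \<bar>n \<alpha> - n \<alpha>'\<bar> y \<le> w) \<Longrightarrow>
      inf \<bar>n \<alpha> - ln\<bar> y \<le> w"
    using positive_locally_Cauchy_limit[OF uc dir locally_Cauchy_contraction[OF cau n]]
    by (auto simp: n_def)
  have "order_converges \<Gamma> le (\<lambda>\<alpha>. inf \<bar>x \<alpha> - (lp - ln)\<bar> y) 0" if y: "0 \<le> y" for y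
  proof -
    obtain w where w: "decreases_to_zero \<Gamma> le w"
      and osc: "\<And>\<beta> \<alpha> \<alpha>'. \<beta> \<in> \<Gamma> \<Longrightarrow> \<alpha> \<in> \<Gamma> \<Longrightarrow> \<alpha>' \<in> \<Gamma> \<Longrightarrow> le \<beta> \<alpha> \<Longrightarrow> le \<beta> \<alpha>' \<Longrightarrow>
        inf \<bar>x \<alpha> - x \<alpha>'\<bar> y \<le> w \<beta>"
      using oscillation_bound[OF oc dir cau y] by blast
    show ?thesis
    proof (rule order_convergesI[OF decreases_to_zero_double[OF w]])
      fix \<beta> assume \<beta>: "\<beta> \<in> \<Gamma>"
      have "\<bar>inf \<bar>x \<alpha> - (lp - ln)\<bar> y - 0\<bar> \<le> w \<beta> + w \<beta>" if \<alpha>: "\<alpha> \<in> \<Gamma>" "le \<beta> \<alpha>" for \<alpha>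
      proof -
        have "x \<alpha> - (lp - ln) = (p \<alpha> - lp) + (ln - n \<alpha>)" by (simp add: x algebra_simps)
        then have "\<bar>x \<alpha> - (lp - ln)\<bar> \<le> \<bar>p \<alpha> - lp\<bar> + \<bar>n \<alpha> - ln\<bar>"
          by (metis abs_minus_commute abs_triangle_ineq)
        then have "inf \<bar>x \<alpha> - (lp - ln)\<bar> y \<le> inf (\<bar>p \<alpha> - lp\<bar> + \<bar>n \<alpha> - ln\<bar>) y"
          by (rule inf_mono) simp
        also have "\<dots> \<le> inf \<bar>p \<alpha> - lp\<bar> y + inf \<bar>n \<alpha> - ln\<bar> y"
          using y by (intro inf_add_le) auto
        also have "\<dots> \<le> w \<beta> + w \<beta>"
        proof (rule add_mono)
          show "inf \<bar>p \<alpha> - lp\<bar> y \<le> w \<beta>"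
            using osc[OF \<beta>] by (intro lp[OF \<beta> \<alpha>] order_trans[OF inf_mono[OF p order_refl]])
          show "inf \<bar>n \<alpha> - ln\<bar> y \<le> w \<beta>"
            using osc[OF \<beta>] by (intro ln[OF \<beta> \<alpha>] order_trans[OF inf_mono[OF n order_refl]])
        qed
        finally show ?thesis using y by (simp add: abs_of_nonneg)
      qed
      then show "\<exists>\<alpha>0\<in>\<Gamma>. \<forall>\<alpha>\<in>\<Gamma>. le \<alpha>0 \<alpha> \<longrightarrow> \<bar>inf \<bar>x \<alpha> - (lp - ln)\<bar> y - 0\<bar> \<le> w \<beta> + w \<beta>"
        using \<beta> by blast
    qed
  qed
  then have "uo_converges \<Gamma> le x (lp - ln)" by (simp add: uo_converges_def)
  then show thesis by (rule that)
qed

lemma universally_complete_imp_uo_complete: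
  assumes uc: "universally_complete TYPE('u::archimedean_vector_lattice)"
  shows "uo_complete TYPE('i) TYPE('u)"
  unfolding uo_complete_def
proof (intro allI impI)
  fix \<Gamma> :: "'i set" and le and x :: "'i \<Rightarrow> 'u"
  assume dir: "directed \<Gamma> le" and "uo_Cauchy \<Gamma> le x"
  moreover have "lattice_embedding (\<lambda>u::'u. u)"
    by (simp add: lattice_embedding_def linear_ident)
  moreover have "order_dense (range (\<lambda>u::'u. u))" by (auto simp: order_dense_def)
  ultimately have "locally_Cauchy \<Gamma> le x" by (intro uo_Cauchy_imp_locally_Cauchy)
  with uc dir show "\<exists>l. uo_converges \<Gamma> le x l" by (rule locally_Cauchy_uo_converges) blast
qed

section \<open>Functionals on order continuous Banach lattices\<close>
definition sublinear :: "('a::real_vector \<Rightarrow> real) \<Rightarrow> bool" where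
  "sublinear p \<longleftrightarrow> (\<forall>x y. p (x + y) \<le> p x + p y) \<and> (\<forall>t\<ge>0. \<forall>x. p (t *\<^sub>R x) = t * p x)"

lemma sublinearI:
  assumes add: "\<And>x y. p (x + y) \<le> p x + p y"
    and zero: "p 0 = 0"
    and scale: "\<And>t x. 0 < t \<Longrightarrow> p (t *\<^sub>R x) \<le> t * p x"
  shows "sublinear p"
proof -
  have "p (t *\<^sub>R x) = t * p x" if "0 \<le> t" for t x
  proof (cases "t = 0")
    case False
    with that have t: "0 < t" by simp
    have "p (inverse t *\<^sub>R (t *\<^sub>R x)) \<le> inverse t * p (t *\<^sub>R x)"
      using t by (intro scale) simp
    then have "t * p x \<le> p (t *\<^sub>R x)" using t by (simp add: field_simps)
    with scale[OF t] show ?thesis by (intro antisym)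
  qed (simp add: zero)
  with add show ?thesis by (simp add: sublinear_def)
qed

lemma sublinear_neg_le:
  assumes "sublinear p" shows "- p (- x) \<le> p x"
proof -
  have "p 0 \<le> p x + p (- x)"
    using assms unfolding sublinear_def by (metis add.right_inverse)
  moreover have "p 0 = 0"
    using assms unfolding sublinear_def by (metis mult_zero_left order_refl scaleR_zero_left)
  ultimately show ?thesis by simp
qed

text \<open>
  The functional \<open>r x = (INF t\<in>{0..}. q (x + t *\<^sub>R y) - t * q y)\<close> is sublinear, and the three bounds
  are the instances \<open>t = 0\<close>, \<open>t = 1\<close>, and \<open>x = - y\<close> with \<open>t = 1\<close>. The second bound yields
  additivity when \<open>q\<close> is minimal; the third one forces every linear functional below
  \<open>r\<close> to take the value \<open>q y\<close> at \<open>y\<close>.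
\<close>
lemma sublinear_descent:
  assumes q: "sublinear q"
  obtains r where "sublinear r" "\<And>x. r x \<le> q x" "\<And>x. r x \<le> q (x + y) - q y"
    "r (- y) \<le> - q y"
proof -
  note add = q[unfolded sublinear_def, THEN conjunct1, rule_format]
  note scale = q[unfolded sublinear_def, THEN conjunct2, rule_format]
  have q0: "q 0 = 0" using scale[of 0 0] by simp
  define h where "h x t = q (x + t *\<^sub>R y) - t * q y" for x t
  define r where "r x = (INF t\<in>{0..}. h x t)" for x
  have "- q (- x) \<le> h x t" if "0 \<le> t" for x t
    using add[of "x + t *\<^sub>R y" "- x"] scale[OF that, of y] by (simp add: h_def)
  then have bdd: "bdd_below (h x ` {0..})" for x
    by (intro bdd_belowI[of _ "- q (- x)"]) auto
  have lower: "r x \<le> h x t" if "0 \<le> t" for x t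
    unfolding r_def using bdd that by (intro cINF_lower) auto
  have greatest: "c \<le> r x" if "\<And>t. 0 \<le> t \<Longrightarrow> c \<le> h x t" for c x
    unfolding r_def using that by (intro cINF_greatest) auto
  have "sublinear r"
  proof (rule sublinearI)
    fix u v
    have sum: "r (u + v) \<le> h u s + h v t" if "0 \<le> s" "0 \<le> t" for s t
    proof -
      have "r (u + v) \<le> h (u + v) (s + t)" using that by (intro lower) simp
      also have "\<dots> \<le> h u s + h v t"
        using add[of "u + s *\<^sub>R y" "v + t *\<^sub>R y"] by (simp add: h_def algebra_simps)
      finally show ?thesis .
    qed
    have "r (u + v) - h u s \<le> r v" if "0 \<le> s" for s
      using sum[OF that] by (intro greatest) (simp add: diff_le_eq add.commute)
    then have "r (u + v) - r v \<le> r u"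
      by (intro greatest) (simp add: diff_le_eq add.commute)
    then show "r (u + v) \<le> r u + r v" by simp
  next
    have "h 0 t = 0" if "0 \<le> t" for t using scale[OF that, of y] by (simp add: h_def)
    then show "r 0 = 0" using lower[of 0 0] greatest[of 0 0] by force
  next
    fix c :: real and x assume c: "0 < c"
    have "inverse c * r (c *\<^sub>R x) \<le> h x t" if t: "0 \<le> t" for t
    proof -
      have "r (c *\<^sub>R x) \<le> h (c *\<^sub>R x) (c * t)" using c t by (intro lower) simp
      also have "\<dots> = c * h x t"
        using scale[of c "x + t *\<^sub>R y"] c by (simp add: h_def algebra_simps)
      finally show ?thesis using c by (simp add: field_simps)
    qed
    then have "inverse c * r (c *\<^sub>R x) \<le> r x" by (rule greatest)
    then show "r (c *\<^sub>R x) \<le> c * r x" using c by (simp add: field_simps)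
  qed
  moreover have "r x \<le> q x" for x using lower[of 0 x] by (simp add: h_def)
  moreover have "r x \<le> q (x + y) - q y" for x using lower[of 1 x] by (simp add: h_def)
  ultimately show thesis
  proof (rule that)
    show "r (- y) \<le> - q y" using lower[of 1 "- y"] q0 by (simp add: h_def)
  qed
qed

text \<open>
  The functional of \<open>sublinear_descent\<close> coincides with a minimal \<open>q\<close>, and its bound
  \<open>q x \<le> q (x + y) - q y\<close> is the inequality missing for additivity.
\<close>
lemma minimal_sublinear_linear:
  assumes q: "sublinear q"
    and minimal: "\<And>r. sublinear r \<Longrightarrow> (\<And>x. r x \<le> q x) \<Longrightarrow> r = q"
  shows "linear q"
proof -
  note scale = q[unfolded sublinear_def, THEN conjunct2, rule_format]
  have add: "q (x + y) = q x + q y" for x y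
  proof -
    obtain r where "sublinear r" "\<And>x. r x \<le> q x" "\<And>x. r x \<le> q (x + y) - q y"
      by (rule sublinear_descent[OF q, of y]) blast
    then have "q x \<le> q (x + y) - q y" using minimal[of r] by auto
    then show ?thesis using q by (intro antisym) (auto simp: sublinear_def)
  qed
  have neg: "q (- x) = - q x" for x
    using add[of x "- x"] scale[of 0 0] by simp
  show ?thesis
  proof (rule linearI)
    fix c :: real and x
    show "q (c *\<^sub>R x) = c *\<^sub>R q x"
      using scale[of c x] scale[of "- c" x] neg[of "c *\<^sub>R x"] by (cases "0 \<le> c") auto
  qed (rule add)
qed

text \<open>
  Zorn's lemma applies because pointwise infima of chains of sublinear functionals below \<open>p\<close> are
  again sublinear; they are finite since such a functional is bounded below by \<open>- p (- x)\<close>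
  at \<open>x\<close>.
\<close>
lemma minimal_sublinear_exists:
  assumes p: "sublinear p"
  obtains m where "sublinear m" "\<And>x. m x \<le> p x"
    "\<And>r. sublinear r \<Longrightarrow> (\<And>x. r x \<le> m x) \<Longrightarrow> r = m"
proof -
  define A where "A = {q. sublinear q \<and> q \<le> p}"
  have "\<exists>m\<in>A. \<forall>a\<in>A. a \<le> m \<longrightarrow> a = m"
  proof (rule predicate_Zorn)
    show "partial_order_on A (relation_of (\<lambda>q r. r \<le> q) A)"
      by (rule partial_order_on_relation_ofI) auto
  next
    fix C assume C: "C \<in> Chains (relation_of (\<lambda>q r. r \<le> q) A)"
    then have CA: "C \<subseteq> A" and tot: "\<And>q r. q \<in> C \<Longrightarrow> r \<in> C \<Longrightarrow> q \<le> r \<or> r \<le> q"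
      by (auto simp: Chains_def relation_of_def)
    show "\<exists>u\<in>A. \<forall>q\<in>C. u \<le> q"
    proof (cases "C = {}")
      case True
      then show ?thesis using p by (auto simp: A_def)
    next
      case False
      define u where "u x = (INF q\<in>C. q x)" for x
      have "- p (- x) \<le> q x" if "q \<in> C" for q x
      proof -
        have "sublinear q" "q (- x) \<le> p (- x)"
          using that CA by (auto simp: A_def le_fun_def)
        then show ?thesis using sublinear_neg_le[of q x] by simp
      qed
      then have lower: "u x \<le> q x" if "q \<in> C" for q x
        unfolding u_def using that
        by (intro cINF_lower bdd_belowI[of _ "- p (- x)"]) auto
      have greatest: "c \<le> u x" if "\<And>q. q \<in> C \<Longrightarrow> c \<le> q x" for c x
        unfolding u_def using that False by (intro cINF_greatest) auto
      have "sublinear u"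
      proof (rule sublinearI)
        fix x y
        have sum: "u (x + y) \<le> q x + r y" if qr: "q \<in> C" "r \<in> C" for q r
        proof -
          obtain s where s: "s \<in> C" "s \<le> q" "s \<le> r" using tot[OF qr] qr by blast
          have "u (x + y) \<le> s (x + y)" using s by (intro lower)
          also have "\<dots> \<le> s x + s y" using s CA by (auto simp: A_def sublinear_def)
          also have "\<dots> \<le> q x + r y" using s by (intro add_mono) (auto simp: le_fun_def)
          finally show ?thesis .
        qed
        have "u (x + y) - q x \<le> u y" if "q \<in> C" for q
          using sum[OF that] by (intro greatest) (simp add: diff_le_eq add.commute)
        then have "u (x + y) - u y \<le> u x"
          by (intro greatest) (simp add: diff_le_eq add.commute)
        then show "u (x + y) \<le> u x + u y" by simp
      next
        have "q 0 = 0" if "q \<in> C" for q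
        proof -
          have "q (0 *\<^sub>R 0) = 0 * q 0" using that CA unfolding A_def sublinear_def by blast
          then show ?thesis by simp
        qed
        then show "u 0 = 0" using False lower[of _ 0] greatest[of 0 0] by force
      next
        fix t :: real and x assume t: "0 < t"
        have "inverse t * u (t *\<^sub>R x) \<le> q x" if "q \<in> C" for q
        proof -
          have "u (t *\<^sub>R x) \<le> q (t *\<^sub>R x)" using that by (rule lower)
          also have "\<dots> = t * q x" using that CA t by (auto simp: A_def sublinear_def)
          finally show ?thesis using t by (simp add: field_simps)
        qed
        then have "inverse t * u (t *\<^sub>R x) \<le> u x" by (rule greatest)
        then show "u (t *\<^sub>R x) \<le> t * u x" using t by (simp add: field_simps)
      qed
      moreover have "u \<le> p"
      proof -
        obtain q where "q \<in> C" using False by blast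
        then show ?thesis using lower[of q] CA unfolding A_def le_fun_def
          by (blast intro: order_trans)
      qed
      ultimately show ?thesis using lower by (auto simp: A_def le_fun_def)
    qed
  qed
  then obtain m where m: "m \<in> A" "\<And>a. a \<in> A \<Longrightarrow> a \<le> m \<Longrightarrow> a = m" by blast
  show thesis
  proof (rule that)
    show "sublinear m" "\<And>x. m x \<le> p x" using m(1) by (auto simp: A_def le_fun_def)
    fix r assume r: "sublinear r" "\<And>x. r x \<le> m x"
    then have "r \<le> m" by (simp add: le_fun_def)
    moreover from this have "r \<in> A" using r(1) m(1) by (auto simp: A_def)
    ultimately show "r = m" using m(2) by blast
  qed
qed

text \<open>
  Descending from \<open>p\<close> along \<open>a\<close> gives a sublinear functional with value at most \<open>- p a\<close> at \<open>- a\<close>.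
  A minimal sublinear functional below it is linear, so its value at \<open>a\<close> is at least \<open>p a\<close>.
\<close>
theorem Hahn_Banach_sublinear:
  assumes p: "sublinear p"
  obtains f where "linear f" "\<And>x. f x \<le> p x" "f a = p a"
proof -
  obtain r where r: "sublinear r" "\<And>x. r x \<le> p x" "r (- a) \<le> - p a"
    by (rule sublinear_descent[OF p, of a]) blast
  obtain f where f: "sublinear f" "\<And>x. f x \<le> r x"
    and min: "\<And>r. sublinear r \<Longrightarrow> (\<And>x. r x \<le> f x) \<Longrightarrow> r = f"
    using minimal_sublinear_exists[OF r(1)] by blast
  have lin: "linear f" using f(1) min by (rule minimal_sublinear_linear)
  have le: "f x \<le> p x" for x using f(2)[of x] r(2)[of x] by linarith
  have "f (- a) \<le> - p a" using f(2) r(3) by (rule order_trans)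
  then have "f a = p a" using le[of a] by (simp add: linear_neg[OF lin])
  with lin le show thesis by (rule that)
qed

lemma norming_functional:
  fixes a :: "'a::real_normed_vector"
  obtains f where "linear f" "\<And>x. \<bar>f x\<bar> \<le> norm x" "f a = norm a"
proof -
  have "sublinear (norm :: 'a \<Rightarrow> real)" by (simp add: sublinear_def norm_triangle_ineq)
  then obtain f where f: "linear f" "\<And>x. f x \<le> norm x" "f a = norm a"
    using Hahn_Banach_sublinear[of norm a] by blast
  have "\<bar>f x\<bar> \<le> norm x" for x
    using f(2)[of x] f(2)[of "- x"] by (simp add: linear_neg[OF f(1)])
  with f show thesis using that by blast
qed

text \<open>
  A net that order converges to \<open>0\<close> is eventually dominated by each member of a net decreasing
  to \<open>0\<close>, whose norms tend to \<open>0\<close>; monotonicity of the norm passes this on to the net and to its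
  images under \<open>f\<close>.
\<close>
lemma bounded_imp_order_continuous:
  fixes f :: "'b::banach_lattice \<Rightarrow> real"
  assumes oc: "order_continuous_norm TYPE('b)"
    and lin: "linear f" and bound: "\<And>x. \<bar>f x\<bar> \<le> norm x"
  shows "f \<in> order_continuous_dual"
proof -
  have "((\<lambda>\<alpha>. f (x \<alpha>)) \<longlongrightarrow> 0) (net_filter \<Gamma> le)"
    if dir: "directed \<Gamma> le" and conv: "order_converges \<Gamma> le x 0"
    for \<Gamma> :: "'b set" and le and x :: "'b \<Rightarrow> 'b"
  proof (rule tendstoI)
    fix e :: real assume e: "0 < e"
    obtain \<Lambda> :: "'b set" and le' a where dec: "decreases_to_zero \<Lambda> le' a"
      and dom: "\<And>\<gamma>. \<gamma> \<in> \<Lambda> \<Longrightarrow> \<exists>\<alpha>0\<in>\<Gamma>. \<forall>\<alpha>\<in>\<Gamma>. le \<alpha>0 \<alpha> \<longrightarrow> \<bar>x \<alpha> - 0\<bar> \<le> a \<gamma>"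
      using conv unfolding order_converges_def by blast
    have dir': "directed \<Lambda> le'" using dec by (simp add: decreases_to_zero_def)
    have "eventually (\<lambda>\<gamma>. dist (norm (a \<gamma>)) 0 < e) (net_filter \<Lambda> le')"
      using order_continuous_normD[OF oc dec] e by (rule tendstoD)
    then obtain \<gamma> where \<gamma>: "\<gamma> \<in> \<Lambda>" "norm (a \<gamma>) < e"
      using dir' unfolding eventually_net_filter[OF dir'] directed_def
      by (auto dest: reflp_onD)
    have "0 \<le> a \<gamma>" using dec \<gamma>(1) by (auto simp: decreases_to_zero_def isGlb_UNIV_iff)
    then have small: "\<bar>f z\<bar> < e" if "\<bar>z\<bar> \<le> a \<gamma>" for z
      using norm_mono[of z "a \<gamma>"] bound[of z] \<gamma>(2) that by simp
    show "eventually (\<lambda>\<alpha>. dist (f (x \<alpha>)) 0 < e) (net_filter \<Gamma> le)"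
      using dom[OF \<gamma>(1)] small unfolding eventually_net_filter[OF dir] by auto
  qed
  with lin show ?thesis by (auto simp: order_continuous_dual_def)
qed

lemma order_continuous_norm_separates:
  assumes "order_continuous_norm TYPE('b::banach_lattice)"
  shows "separates_points (order_continuous_dual :: ('b \<Rightarrow> real) set)"
  unfolding separates_points_def
proof (intro allI impI)
  fix a :: 'b assume "a \<noteq> 0"
  obtain f where f: "linear f" "\<And>x. \<bar>f x\<bar> \<le> norm x" "f a = norm a"
    using norming_functional[of a] by blast
  have "f \<in> order_continuous_dual" using assms f(1,2) by (rule bounded_imp_order_continuous)
  moreover have "f a \<noteq> 0" using f(3) \<open>a \<noteq> 0\<close> by simp
  ultimately show "\<exists>f\<in>order_continuous_dual. f a \<noteq> 0" by blast
qed

section \<open>Uo-completeness of the universal completion\<close>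
theorem corollary2p12:
  fixes J :: "'a::archimedean_vector_lattice \<Rightarrow> 'u::archimedean_vector_lattice"
  shows "(separates_points (order_continuous_dual :: ('a \<Rightarrow> real) set) \<longrightarrow>
            universal_completion J \<longrightarrow>
            uo_complete TYPE('i) TYPE('u) \<and>
            (\<forall>(\<Gamma> :: 'j set) le (x :: 'j \<Rightarrow> 'a).
               directed \<Gamma> le \<longrightarrow> uo_Cauchy \<Gamma> le x \<longrightarrow>
               (\<exists>u. uo_converges \<Gamma> le (\<lambda>\<alpha>. J (x \<alpha>)) u)))
       \<and> (order_continuous_norm TYPE('b::banach_lattice) \<longrightarrow>
            separates_points (order_continuous_dual :: ('b \<Rightarrow> real) set))"
proof (intro conjI impI allI)
  assume "universal_completion J"
  then have uc: "universally_complete TYPE('u)" and J: "lattice_embedding J"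
    and dense: "order_dense (range J)"
    by (simp_all add: universal_completion_def)
  show "uo_complete TYPE('i) TYPE('u)"
    using uc by (rule universally_complete_imp_uo_complete)
  fix \<Gamma> :: "'j set" and le and x :: "'j \<Rightarrow> 'a"
  assume dir: "directed \<Gamma> le" and cau: "uo_Cauchy \<Gamma> le x"
  have "locally_Cauchy \<Gamma> le (\<lambda>\<alpha>. J (x \<alpha>))"
    using J dense dir cau by (rule uo_Cauchy_imp_locally_Cauchy)
  then obtain u where "uo_converges \<Gamma> le (\<lambda>\<alpha>. J (x \<alpha>)) u"
    by (rule locally_Cauchy_uo_converges[OF uc dir])
  then show "\<exists>u. uo_converges \<Gamma> le (\<lambda>\<alpha>. J (x \<alpha>)) u" by blast
next
  assume "order_continuous_norm TYPE('b)"
  then show "separates_points (order_continuous_dual :: ('b \<Rightarrow> real) set)"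
    by (rule order_continuous_norm_separates)
qed

end
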